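(* Let $d\ge 1$, $\Omega=[0,1)^d$, let $I\subset\mathbb{Z}^d$ be a finite index set, let $\eta\in(0,1)$, and let $\boldsymbol{x}_0,\dots,\boldsymbol{x}_{N-1}$ be $N\ge 1$ points of $\Omega$ such that $$\left|\frac1N\sum_{n=0}^{N-1}|p(\boldsymbol{x}_n)|^2-\int_\Omega |p(\boldsymbol{x})|^2\,d\boldsymbol{x}\right|\le \eta\int_\Omega |p(\boldsymbol{x})|^2\,d\boldsymbol{x}\qquad\text{for all }p\in\mathbb{P}_I(\Omega).$$ Let $f\in L_2(\Omega)$ and let $$\mathcal{Q}_I f:=\sum_{\boldsymbol{h}\in I}\langle f,q_{\boldsymbol{h}}\rangle_N\, q_{\boldsymbol{h}}.$$ Then $$\|\mathcal{Q}_I f\|_{L_2}\le\sqrt{1+\eta}\,\|f\|_\infty ,$$ and $$\|\mathcal{Q}_I f-f\|_{L_2}\le\left(\sqrt{1+\eta}+1\right)E_I(f)+\|\mathcal{Q}_I p^*-p^*\|_{L_2},$$ where $p^*\in\mathbb{P}_I(\Omega)$ denotes the best approximation of $f$ from $\mathbb{P}_I(\Omega)$ in the uniform norm and $E_I(f)=\|f-p^*\|_\infty$.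
   Context: $L_2(\Omega)$ is the space of square-integrable functions on $\Omega$ with inner product $\langle f,g\rangle=\int_\Omega f(\boldsymbol{x})\overline{g(\boldsymbol{x})}\,d\boldsymbol{x}$ and norm $\|f\|_{L_2}=\sqrt{\langle f,f\rangle}$. The functions $q_{\boldsymbol{h}}:\Omega\to\mathbb{C}$ (indexed by multi-indices $\boldsymbol{h}$ in an index family contained in $\mathbb{Z}^d$ and containing $I$) form an orthonormal basis of $L_2(\Omega)$, and $\mathbb{P}_I(\Omega)=\mathrm{span}\{q_{\boldsymbol{h}}:\boldsymbol{h}\in I\}$ (complex linear span). The discrete inner product is $\langle v,z\rangle_N=\frac1N\sum_{n=0}^{N-1}v(\boldsymbol{x}_n)\overline{z(\boldsymbol{x}_n)}$. All functions (including $f$ and the $q_{\boldsymbol{h}}$) are functions defined at every point of $\Omega$, so that point evaluation makes sense, and $\|f\|_\infty=\sup_{\boldsymbol{x}\in\Omega}|f(\boldsymbol{x})|$ is the uniform norm (possibly $+\infty$). "$p^*$ is the best approximation of $f$ in the uniform norm" means $p^*\in\mathbb{P}_I(\Omega)$ and $\|f-p^*\|_\infty=\inf_{p\in\mathbb{P}_I(\Omega)}\|f-p\|_\infty$. *)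

theory Defs
  imports "HOL-Analysis.Analysis" "HOL-Library.Function_Algebras"
begin

text \<open>
  Functions \<open>\<Omega> \<rightarrow> \<complex>\<close> are represented by total functions on \<open>real ^ 'd\<close>. Every integral,
  supremum and point evaluation below only looks at \<open>\<Omega>\<close>, so values outside \<open>\<Omega>\<close> are irrelevant.
  \<open>L\<^sub>2(\<Omega>)\<close> consists of functions, not of equivalence classes, so that point evaluation makes sense.
\<close>

definition Omega :: "(real ^ 'd) set" where
  "Omega = {x. \<forall>i. 0 \<le> x $ i \<and> x $ i < 1}"

definition L2_space :: "(real ^ 'd \<Rightarrow> complex) set" where
  "L2_space = {f. f \<in> borel_measurable (lebesgue_on Omega) \<and>
                  integrable (lebesgue_on Omega) (\<lambda>x. (cmod (f x))\<^sup>2)}"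

definition L2_inner :: "(real ^ 'd \<Rightarrow> complex) \<Rightarrow> (real ^ 'd \<Rightarrow> complex) \<Rightarrow> complex" where
  "L2_inner f g = (LINT x|lebesgue_on Omega. f x * cnj (g x))"

definition L2_norm :: "(real ^ 'd \<Rightarrow> complex) \<Rightarrow> real" where
  "L2_norm f = sqrt (Re (L2_inner f f))"

definition unif_norm :: "(real ^ 'd \<Rightarrow> complex) \<Rightarrow> ennreal" where
  "unif_norm f = (SUP x\<in>Omega. ennreal (cmod (f x)))"

definition disc_inner ::
  "nat \<Rightarrow> (nat \<Rightarrow> real ^ 'd) \<Rightarrow> (real ^ 'd \<Rightarrow> complex) \<Rightarrow> (real ^ 'd \<Rightarrow> complex) \<Rightarrow> complex" where
  "disc_inner N x v z = (1 / of_nat N) * (\<Sum>n<N. v (x n) * cnj (z (x n)))"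

global_interpretation cfun: vector_space "\<lambda>(c::complex) (g::'a \<Rightarrow> complex) x. c * g x"
  defines cfun_span = cfun.span
  by unfold_locales (auto simp: fun_eq_iff algebra_simps)

definition P_space ::
  "(int ^ 'd \<Rightarrow> real ^ 'd \<Rightarrow> complex) \<Rightarrow> (int ^ 'd) set \<Rightarrow> (real ^ 'd \<Rightarrow> complex) set" where
  "P_space q I = cfun_span (q ` I)"

text \<open>Orthonormal basis in the Hilbert space sense: orthonormal with dense linear span.\<close>

definition orthonormal_basis_L2 ::
  "(int ^ 'd) set \<Rightarrow> (int ^ 'd \<Rightarrow> real ^ 'd \<Rightarrow> complex) \<Rightarrow> bool" where
  "orthonormal_basis_L2 J q \<longleftrightarrow>
     (\<forall>h\<in>J. q h \<in> L2_space) \<and>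
     (\<forall>h\<in>J. \<forall>k\<in>J. L2_inner (q h) (q k) = (if h = k then 1 else 0)) \<and>
     (\<forall>g\<in>L2_space. \<forall>\<epsilon>>0. \<exists>p\<in>P_space q J. L2_norm (g - p) < \<epsilon>)"

definition Q_op ::
  "nat \<Rightarrow> (nat \<Rightarrow> real ^ 'd) \<Rightarrow> (int ^ 'd \<Rightarrow> real ^ 'd \<Rightarrow> complex) \<Rightarrow> (int ^ 'd) set
     \<Rightarrow> (real ^ 'd \<Rightarrow> complex) \<Rightarrow> (real ^ 'd \<Rightarrow> complex)" where
  "Q_op N x q I f = (\<lambda>y. \<Sum>h\<in>I. disc_inner N x f (q h) * q h y)"

definition best_unif_approx ::
  "(real ^ 'd \<Rightarrow> complex) set \<Rightarrow> (real ^ 'd \<Rightarrow> complex) \<Rightarrow> (real ^ 'd \<Rightarrow> complex) \<Rightarrow> bool" where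
  "best_unif_approx P f p \<longleftrightarrow>
     p \<in> P \<and> unif_norm (f - p) = (INF r\<in>P. unif_norm (f - r))"

end

theory Submission
  imports Defs
begin

text \<open>
  With \<open>u = \<Q>\<^sub>I f\<close>, Parseval gives \<open>\<parallel>u\<parallel>\<^sup>2 = \<langle>f, u\<rangle>\<^sub>N\<close>. The discrete Cauchy--Schwarz inequality and the
  Marcinkiewicz--Zygmund hypothesis applied to \<open>u\<close> bound the right-hand side by
  \<open>\<parallel>f\<parallel>\<^sub>\<infinity> \<surd>(1 + \<eta>) \<parallel>u\<parallel>\<close>. The error bound follows by splitting
  \<open>\<Q>\<^sub>I f - f = \<Q>\<^sub>I (f - p) + (p - f) + (\<Q>\<^sub>I p - p)\<close> and using that \<open>\<Omega>\<close> has measure 1.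
\<close>

section \<open>The half-open cube: measurability and volume\<close>

lemma borel_Omega: "(Omega :: (real ^ 'd) set) \<in> sets borel"
proof -
  have "Omega = (\<Inter>i. {x :: real ^ 'd. 0 \<le> x $ i} \<inter> {x. x $ i < 1})"
    by (auto simp: Omega_def)
  also have "\<dots> \<in> sets borel"
    by (intro sets.finite_INT sets.Int borel_closed borel_open)
      (auto intro!: closed_Collect_le open_Collect_less continuous_intros)
  finally show ?thesis .
qed

lemma Omega_subset_cbox: "(Omega :: (real ^ 'd) set) \<subseteq> cbox 0 1"
  by (auto simp: Omega_def mem_box_cart less_imp_le)

lemma lmeasurable_Omega: "(Omega :: (real ^ 'd) set) \<in> lmeasurable"
  using borel_Omega bounded_subset[OF bounded_cbox Omega_subset_cbox]
  by (auto intro!: bounded_set_imp_lmeasurable)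

lemma measure_Omega_le_1: "measure lebesgue (Omega :: (real ^ 'd) set) \<le> 1"
proof -
  have "measure lebesgue (Omega :: (real ^ 'd) set) \<le> measure lebesgue (cbox 0 (1 :: real ^ 'd))"
    by (rule measure_mono_fmeasurable) (use Omega_subset_cbox lmeasurable_Omega in auto)
  also have "\<dots> = 1"
    using content_cbox_cart[of "0 :: real ^ 'd" 1] by (simp add: interval_ne_empty_cart)
  finally show ?thesis .
qed

lemma finite_measure_Omega: "finite_measure (lebesgue_on (Omega :: (real ^ 'd) set))"
  using lmeasurable_Omega
  by (metis finite_measure_lebesgue_on)

section \<open>The square-integrable functions as a seminormed space\<close>

lemma L2_norm_eq: "L2_norm f = sqrt (LINT x|lebesgue_on Omega. (cmod (f x))\<^sup>2)"
proof -
  have "L2_inner f f = (LINT x|lebesgue_on Omega. complex_of_real ((cmod (f x))\<^sup>2))"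
    by (simp only: L2_inner_def complex_norm_square)
  then show ?thesis
    by (simp only: L2_norm_def integral_complex_of_real Re_complex_of_real)
qed

lemma L2_norm_nonneg: "0 \<le> L2_norm f"
  by (simp add: L2_norm_eq)

lemma L2_norm_power2: "(L2_norm f)\<^sup>2 = (LINT x|lebesgue_on Omega. (cmod (f x))\<^sup>2)"
  by (simp add: L2_norm_eq)

lemma L2_norm_minus_commute: "L2_norm (f - g) = L2_norm (g - f)"
  by (simp add: L2_norm_eq norm_minus_commute)

text \<open>Young's inequality with a free weight \<open>t\<close>: the cross term
  \<open>2 * norm a * norm b\<close> is absorbed by the nonnegative square
  \<open>(t * norm a - norm b)\<^sup>2 / t\<close>. The weight 1 gives closure under addition; an
  optimised weight gives the triangle inequality.\<close>

lemma norm_add_square_le: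
  fixes a b :: "'a::real_normed_vector"
  assumes "t > 0"
  shows "(norm (a + b))\<^sup>2 \<le> (1 + t) * (norm a)\<^sup>2 + (1 + 1 / t) * (norm b)\<^sup>2"
proof -
  have "(norm (a + b))\<^sup>2 \<le> (norm a + norm b)\<^sup>2"
    by (simp add: norm_triangle_ineq power_mono)
  also have "\<dots> \<le> (1 + t) * (norm a)\<^sup>2 + (1 + 1 / t) * (norm b)\<^sup>2"
  proof -
    have "0 \<le> (t * norm a - norm b)\<^sup>2 / t"
      using assms by simp
    also have "\<dots> = t * (norm a)\<^sup>2 + (norm b)\<^sup>2 / t - 2 * norm a * norm b"
      using assms by (simp add: field_simps power2_eq_square)
    finally show ?thesis by (simp add: algebra_simps power2_sum)
  qed
  finally show ?thesis .
qed

lemma L2_space_add: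
  assumes "f \<in> L2_space" "g \<in> L2_space"
  shows "f + g \<in> L2_space"
proof -
  have [measurable]: "f \<in> borel_measurable (lebesgue_on Omega)" "g \<in> borel_measurable (lebesgue_on Omega)"
    using assms by (auto simp: L2_space_def)
  have "integrable (lebesgue_on Omega) (\<lambda>x. (cmod (f x + g x))\<^sup>2)"
  proof (rule Bochner_Integration.integrable_bound)
    show "integrable (lebesgue_on Omega) (\<lambda>x. 2 * (cmod (f x))\<^sup>2 + 2 * (cmod (g x))\<^sup>2)"
      using assms by (simp add: L2_space_def)
  qed (use norm_add_square_le[of 1 "f _" "g _"] in auto)
  then show ?thesis by (simp add: L2_space_def plus_fun_def)
qed

lemma L2_space_cmult:
  assumes "f \<in> L2_space"
  shows "(\<lambda>x. c * f x) \<in> L2_space"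
  using assms by (auto simp: L2_space_def norm_mult power_mult_distrib)

lemma L2_space_diff:
  assumes "f \<in> L2_space" "g \<in> L2_space"
  shows "f - g \<in> L2_space"
  using L2_space_add[OF assms(1) L2_space_cmult[OF assms(2), of "-1"]]
  by (simp add: plus_fun_def fun_diff_def)

text \<open>Integrating the weighted Young inequality bounds the squared norm of the sum for every
  weight \<open>t > 0\<close>; choosing the best weight turns this into Minkowski's inequality,
  without passing through Cauchy-Schwarz for integrals.\<close>

lemma L2_norm_triangle:
  assumes "f \<in> L2_space" "g \<in> L2_space"
  shows "L2_norm (f + g) \<le> L2_norm f + L2_norm g"
proof (rule field_le_epsilon)
  fix e :: real assume "e > 0"
  \<comment> \<open>The added \<open>e / 2\<close> keeps \<open>a\<close> and \<open>b\<close>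
    strictly positive, so that their quotient is a legitimate weight even when a norm
    vanishes.\<close>
  define a where "a = L2_norm f + e / 2"
  define b where "b = L2_norm g + e / 2"
  have pos: "a > 0" "b > 0" and le: "L2_norm f \<le> a" "L2_norm g \<le> b"
    using \<open>e > 0\<close> L2_norm_nonneg[of f] L2_norm_nonneg[of g] by (simp_all add: a_def b_def)
  \<comment> \<open>This weight makes \<open>(1 + t) * a\<^sup>2 + (1 + 1 / t) * b\<^sup>2\<close>
    collapse to the perfect square \<open>(a + b)\<^sup>2\<close>.\<close>
  define t where "t = b / a"
  have "t > 0" using pos by (simp add: t_def)
  have int: "integrable (lebesgue_on Omega) (\<lambda>x. (cmod (f x))\<^sup>2)"
    "integrable (lebesgue_on Omega) (\<lambda>x. (cmod (g x))\<^sup>2)"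
    "integrable (lebesgue_on Omega) (\<lambda>x. (cmod (f x + g x))\<^sup>2)"
    using assms L2_space_add[OF assms] by (simp_all add: L2_space_def plus_fun_def)
  have "(L2_norm (f + g))\<^sup>2
      \<le> (LINT x|lebesgue_on Omega. (1 + t) * (cmod (f x))\<^sup>2 + (1 + 1 / t) * (cmod (g x))\<^sup>2)"
    unfolding L2_norm_power2 plus_fun_apply
    by (rule integral_mono) (use int norm_add_square_le[OF \<open>t > 0\<close>] in auto)
  also have "\<dots> = (1 + t) * (L2_norm f)\<^sup>2 + (1 + 1 / t) * (L2_norm g)\<^sup>2"
    using int by (simp add: L2_norm_power2)
  also have "\<dots> \<le> (1 + t) * a\<^sup>2 + (1 + 1 / t) * b\<^sup>2"
    using \<open>t > 0\<close> le L2_norm_nonneg by (intro add_mono mult_left_mono power_mono) auto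
  also have "\<dots> = (a + b)\<^sup>2"
    using pos by (simp add: t_def field_simps power2_eq_square)
  finally have "L2_norm (f + g) \<le> a + b"
    by (rule power2_le_imp_le) (use pos in simp)
  then show "L2_norm (f + g) \<le> L2_norm f + L2_norm g + e"
    by (simp add: a_def b_def)
qed

text \<open>The product is dominated pointwise by the integrable sum of the two squared moduli. This
  is what allows inner products of linear combinations to be expanded term by term.\<close>

lemma integrable_L2_mult_cnj:
  assumes "f \<in> L2_space" "g \<in> L2_space"
  shows "integrable (lebesgue_on Omega) (\<lambda>x. f x * cnj (g x))"
proof (rule Bochner_Integration.integrable_bound)
  have [measurable]: "f \<in> borel_measurable (lebesgue_on Omega)" "g \<in> borel_measurable (lebesgue_on Omega)"
    using assms by (auto simp: L2_space_def)
  have "(\<lambda>x. cnj (g x)) \<in> borel_measurable (lebesgue_on Omega)"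
    using borel_measurable_continuous_onI[OF continuous_on_cnj[OF continuous_on_id]] by measurable
  then show "(\<lambda>x. f x * cnj (g x)) \<in> borel_measurable (lebesgue_on Omega)"
    by measurable
  show "integrable (lebesgue_on Omega) (\<lambda>x. (cmod (f x))\<^sup>2 + (cmod (g x))\<^sup>2)"
    using assms by (simp add: L2_space_def)
  have "a * b \<le> a\<^sup>2 + b\<^sup>2" if "a \<ge> 0" "b \<ge> 0" for a b :: real
    using sum_squares_bound[of a b] mult_nonneg_nonneg[OF that] by linarith
  then show "AE x in lebesgue_on Omega.
      norm (f x * cnj (g x)) \<le> norm ((cmod (f x))\<^sup>2 + (cmod (g x))\<^sup>2)"
    by (simp add: norm_mult)
qed

section \<open>Finite linear combinations and the spanned space\<close>

lemma L2_inner_lincomb: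
  assumes "\<And>h. h \<in> I \<Longrightarrow> q h \<in> L2_space"
  shows "L2_inner (\<lambda>y. \<Sum>h\<in>I. c h * q h y) (\<lambda>y. \<Sum>h\<in>I. c h * q h y)
    = (\<Sum>h\<in>I. \<Sum>k\<in>I. c h * cnj (c k) * L2_inner (q h) (q k))"
proof -
  have "(\<Sum>h\<in>I. c h * q h y) * cnj (\<Sum>h\<in>I. c h * q h y)
      = (\<Sum>h\<in>I. \<Sum>k\<in>I. c h * cnj (c k) * (q h y * cnj (q k y)))" for y
    by (simp add: sum_product mult_ac)
  then have "L2_inner (\<lambda>y. \<Sum>h\<in>I. c h * q h y) (\<lambda>y. \<Sum>h\<in>I. c h * q h y)
      = (LINT y|lebesgue_on Omega. (\<Sum>h\<in>I. \<Sum>k\<in>I. c h * cnj (c k) * (q h y * cnj (q k y))))"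
    by (simp only: L2_inner_def)
  also have "\<dots> = (\<Sum>h\<in>I. \<Sum>k\<in>I. (LINT y|lebesgue_on Omega. c h * cnj (c k) * (q h y * cnj (q k y))))"
    by (simp only: Bochner_Integration.integral_sum Bochner_Integration.integrable_sum
        integrable_mult_right integrable_L2_mult_cnj assms cong: sum.cong)
  finally show ?thesis
    by (simp add: L2_inner_def)
qed

text \<open>Parseval's identity: orthonormality leaves only the diagonal of the double sum.\<close>

lemma L2_norm_lincomb:
  assumes "finite I" and "\<And>h. h \<in> I \<Longrightarrow> q h \<in> L2_space"
    and "\<And>h k. h \<in> I \<Longrightarrow> k \<in> I \<Longrightarrow> L2_inner (q h) (q k) = (if h = k then 1 else 0)"
  shows "(L2_norm (\<lambda>y. \<Sum>h\<in>I. c h * q h y))\<^sup>2 = (\<Sum>h\<in>I. (cmod (c h))\<^sup>2)"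
proof -
  have "L2_inner (\<lambda>y. \<Sum>h\<in>I. c h * q h y) (\<lambda>y. \<Sum>h\<in>I. c h * q h y)
      = (\<Sum>h\<in>I. \<Sum>k\<in>I. if h = k then c h * cnj (c k) else 0)"
    using assms by (auto simp: L2_inner_lincomb mult_delta_right intro!: sum.cong)
  also have "\<dots> = complex_of_real (\<Sum>h\<in>I. (cmod (c h))\<^sup>2)"
    using assms(1) by (simp add: complex_norm_square del: of_real_power)
  finally show ?thesis
    by (simp add: L2_norm_def sum_nonneg)
qed

text \<open>This places every \<open>Q_op N x q I g\<close> in the span, so that the sampling
  hypothesis can be applied to it.\<close>

lemma P_space_lincomb: "(\<lambda>y. \<Sum>h\<in>I. c h * q h y) \<in> P_space q I"
proof -
  have "(\<Sum>h\<in>I. (\<lambda>y. c h * q h y)) \<in> P_space q I"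
    unfolding P_space_def
    by (intro cfun.span_sum cfun.span_scale cfun.span_base) auto
  \<comment> \<open>The closure rules of the span concern sums of functions, while
    \<open>Q_op\<close> is written pointwise. For infinite \<open>I\<close> both sums are 0 by
    convention.\<close>
  also have "(\<Sum>h\<in>I. (\<lambda>y. c h * q h y)) = (\<lambda>y. \<Sum>h\<in>I. c h * q h y)"
    by (rule ext, induction I rule: infinite_finite_induct) auto
  finally show ?thesis .
qed

lemma P_space_subset_L2_space:
  assumes "\<And>h. h \<in> I \<Longrightarrow> q h \<in> L2_space"
  shows "P_space q I \<subseteq> L2_space"
proof
  fix p assume "p \<in> P_space q I"
  then show "p \<in> L2_space"
    unfolding P_space_def
  proof (induction rule: cfun.span_induct_alt)
    case base
    then show ?case by (simp add: L2_space_def zero_fun_def)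
  next
    case (step c a b)
    then show ?case using L2_space_add[OF L2_space_cmult] assms by blast
  qed
qed

section \<open>Linearity and the discrete Cauchy-Schwarz bound\<close>

lemma disc_inner_diff: "disc_inner N x (f - g) z = disc_inner N x f z - disc_inner N x g z"
  by (simp add: disc_inner_def sum_subtractf algebra_simps)

lemma Q_op_diff: "Q_op N x q I (f - g) = Q_op N x q I f - Q_op N x q I g"
  by (simp add: Q_op_def disc_inner_diff sum_subtractf algebra_simps fun_eq_iff)

text \<open>The coefficients of \<open>Q_op\<close> are themselves discrete inner products, so their
  squared moduli add up to the discrete inner product of \<open>f\<close> with
  \<open>Q_op N x q I f\<close>. Bounding \<open>f\<close> by \<open>M\<close> at the nodes and
  applying Cauchy-Schwarz leaves a discrete norm of \<open>Q_op N x q I f\<close>.\<close>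

lemma sum_norm_disc_inner_le:
  assumes "\<And>n. n < N \<Longrightarrow> cmod (f (x n)) \<le> M" and "M \<ge> 0"
  shows "(\<Sum>h\<in>I. (cmod (disc_inner N x f (q h)))\<^sup>2)
    \<le> M * sqrt ((1 / real N) * (\<Sum>n<N. (cmod (Q_op N x q I f (x n)))\<^sup>2))"
proof -
  let ?u = "Q_op N x q I f"
  have "complex_of_real (\<Sum>h\<in>I. (cmod (disc_inner N x f (q h)))\<^sup>2) = disc_inner N x f ?u"
  proof -
    have "disc_inner N x f ?u
        = (\<Sum>n<N. \<Sum>h\<in>I. cnj (disc_inner N x f (q h)) * ((1 / of_nat N) * (f (x n) * cnj (q h (x n)))))"
      unfolding disc_inner_def[of N x f ?u]
      by (simp add: Q_op_def sum_distrib_left mult_ac)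
    also have "\<dots> = (\<Sum>h\<in>I. cnj (disc_inner N x f (q h)) * disc_inner N x f (q h))"
      by (subst sum.swap) (simp only: disc_inner_def[of N x f] sum_distrib_left)
    finally show ?thesis by (simp only: of_real_sum complex_norm_square mult.commute)
  qed
  \<comment> \<open>A sum of squares is a nonnegative real, hence equals its own modulus.\<close>
  from this[symmetric] have "(\<Sum>h\<in>I. (cmod (disc_inner N x f (q h)))\<^sup>2) = cmod (disc_inner N x f ?u)"
    by (simp only: norm_of_real) (simp add: sum_nonneg)
  also have "\<dots> \<le> (1 / real N) * (\<Sum>n<N. M * cmod (?u (x n)))"
  proof -
    have "cmod (\<Sum>n<N. f (x n) * cnj (?u (x n))) \<le> (\<Sum>n<N. M * cmod (?u (x n)))"
      by (rule sum_norm_le) (use assms in \<open>auto simp: norm_mult intro!: mult_right_mono\<close>)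
    then show ?thesis
      by (simp add: disc_inner_def norm_mult norm_divide divide_right_mono)
  qed
  also have "\<dots> = M * ((1 / real N) * (\<Sum>n<N. cmod (?u (x n))))"
    by (simp add: sum_distrib_left)
  also have "\<dots> \<le> M * sqrt ((1 / real N) * (\<Sum>n<N. (cmod (?u (x n)))\<^sup>2))"
  proof (rule mult_left_mono[OF real_le_rsqrt \<open>M \<ge> 0\<close>])
    \<comment> \<open>Cauchy-Schwarz against the constant 1; the resulting factor \<open>N\<close>
      cancels one of the two factors \<open>1 / N\<close> in the square of the mean.\<close>
    have "(\<Sum>n<N. cmod (?u (x n)))\<^sup>2 \<le> (\<Sum>n<N. (cmod (?u (x n)))\<^sup>2) * real N"
      using Cauchy_Schwarz_ineq_sum[of "\<lambda>n. cmod (?u (x n))" "\<lambda>_. 1" "{..<N}"] by simp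
    then show "((1 / real N) * (\<Sum>n<N. cmod (?u (x n))))\<^sup>2
        \<le> (1 / real N) * (\<Sum>n<N. (cmod (?u (x n)))\<^sup>2)"
      by (cases "N = 0") (simp_all add: field_simps power2_eq_square)
  qed
  finally show ?thesis .
qed

section \<open>Pointwise bounds and the uniform norm\<close>

lemma L2_norm_le_bound:
  assumes "f \<in> L2_space" and "\<And>y. y \<in> Omega \<Longrightarrow> cmod (f y) \<le> M" and "M \<ge> 0"
  shows "L2_norm f \<le> M"
proof -
  interpret finite_measure "lebesgue_on (Omega :: (real ^ 'a) set)"
    by (rule finite_measure_Omega)
  have "(LINT x|lebesgue_on Omega. (cmod (f x))\<^sup>2) \<le> (LINT x|lebesgue_on (Omega :: (real ^ 'a) set). M\<^sup>2)"
    by (rule integral_mono) (use assms in \<open>auto simp: L2_space_def power_mono\<close>)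
  also have "\<dots> = measure lebesgue (Omega :: (real ^ 'a) set) * M\<^sup>2"
    by (simp add: measure_restrict_space fmeasurableD[OF lmeasurable_Omega])
  \<comment> \<open>Volume at most 1 means that the constant \<open>M\<close> passes through with no
    extra factor.\<close>
  also have "\<dots> \<le> M\<^sup>2"
    by (intro mult_left_le_one_le measure_Omega_le_1) simp_all
  finally show ?thesis
    using \<open>M \<ge> 0\<close> by (simp add: L2_norm_eq real_le_lsqrt)
qed

text \<open>Separates the infinite case, where the estimates are trivial, from the finite one, where
  the argument can run over the reals with a pointwise bound \<open>M\<close>.\<close>

lemma unif_norm_cases:
  obtains (infinite) "unif_norm f = top"
  | (finite) M where "unif_norm f = ennreal M" "M \<ge> 0" "\<And>y. y \<in> Omega \<Longrightarrow> cmod (f y) \<le> M"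
proof (cases "unif_norm f" rule: ennreal_cases)
  case (real M)
  have "cmod (f y) \<le> M" if "y \<in> Omega" for y
  proof -
    have "ennreal (cmod (f y)) \<le> unif_norm f"
      unfolding unif_norm_def using that by (rule SUP_upper)
    then show ?thesis using real by simp
  qed
  then show ?thesis using real finite by blast
qed (rule infinite)


theorem theorem3p3:
  fixes I J :: "(int ^ 'd) set"
    and q :: "int ^ 'd \<Rightarrow> real ^ 'd \<Rightarrow> complex"
    and \<eta> :: real
    and N :: nat
    and x :: "nat \<Rightarrow> real ^ 'd"
    and f :: "real ^ 'd \<Rightarrow> complex"
  assumes "finite I" and "I \<subseteq> J"
    and "orthonormal_basis_L2 J q"
    and "0 < \<eta>" and "\<eta> < 1"
    and "N \<ge> 1" and "\<And>n. n < N \<Longrightarrow> x n \<in> Omega"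
    and "\<And>p. p \<in> P_space q I \<Longrightarrow>
           \<bar>(1 / real N) * (\<Sum>n<N. (cmod (p (x n)))\<^sup>2)
              - (LINT y|lebesgue_on Omega. (cmod (p y))\<^sup>2)\<bar>
           \<le> \<eta> * (LINT y|lebesgue_on Omega. (cmod (p y))\<^sup>2)"
    and "f \<in> L2_space"
  shows "ennreal (L2_norm (Q_op N x q I f)) \<le> ennreal (sqrt (1 + \<eta>)) * unif_norm f
    \<and> (\<forall>pstar. best_unif_approx (P_space q I) f pstar \<longrightarrow>
         ennreal (L2_norm (Q_op N x q I f - f))
           \<le> ennreal (sqrt (1 + \<eta>) + 1) * unif_norm (f - pstar)
             + ennreal (L2_norm (Q_op N x q I pstar - pstar)))"
proof -
  have qL2: "q h \<in> L2_space" if "h \<in> I" for h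
    using assms(2,3) that unfolding orthonormal_basis_L2_def by blast
  have orth: "L2_inner (q h) (q k) = (if h = k then 1 else 0)" if "h \<in> I" "k \<in> I" for h k
    using assms(2,3) that unfolding orthonormal_basis_L2_def by blast
  have Q_in_P: "Q_op N x q I g \<in> P_space q I" for g
    unfolding Q_op_def by (rule P_space_lincomb)
  have P_L2: "p \<in> L2_space" if "p \<in> P_space q I" for p
    by (rule subsetD[OF P_space_subset_L2_space[OF qL2] that])
  \<comment> \<open>Stated for arbitrary \<open>g\<close> because it serves twice: for
    \<open>f\<close> in the first claim and for \<open>f - p\<close> in the second.\<close>
  have stability: "L2_norm (Q_op N x q I g) \<le> sqrt (1 + \<eta>) * M"
    if bound: "\<And>y. y \<in> Omega \<Longrightarrow> cmod (g y) \<le> M" and "M \<ge> 0" for g M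
  proof -
    let ?u = "Q_op N x q I g"
    \<comment> \<open>The upper half of the sampling hypothesis, applied to the approximant
      itself.\<close>
    have MZ: "(1 / real N) * (\<Sum>n<N. (cmod (?u (x n)))\<^sup>2) \<le> (1 + \<eta>) * (L2_norm ?u)\<^sup>2"
      using assms(8)[OF Q_in_P[of g]] by (simp add: L2_norm_power2 algebra_simps)
    have "(L2_norm ?u)\<^sup>2 = (\<Sum>h\<in>I. (cmod (disc_inner N x g (q h)))\<^sup>2)"
      unfolding Q_op_def by (rule L2_norm_lincomb) (use assms(1) qL2 orth in auto)
    also have "\<dots> \<le> M * sqrt ((1 / real N) * (\<Sum>n<N. (cmod (?u (x n)))\<^sup>2))"
      by (rule sum_norm_disc_inner_le) (use bound assms(7) \<open>M \<ge> 0\<close> in auto)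
    also have "\<dots> \<le> M * sqrt ((1 + \<eta>) * (L2_norm ?u)\<^sup>2)"
      by (intro mult_left_mono real_sqrt_le_mono MZ \<open>M \<ge> 0\<close>)
    also have "\<dots> = sqrt (1 + \<eta>) * M * L2_norm ?u"
      by (simp add: real_sqrt_mult L2_norm_nonneg)
    finally have "L2_norm ?u * L2_norm ?u \<le> sqrt (1 + \<eta>) * M * L2_norm ?u"
      by (simp add: power2_eq_square)
    \<comment> \<open>One factor \<open>L2_norm ?u\<close> cancels if it is nonzero; otherwise the
      claim reduces to nonnegativity of the right-hand side.\<close>
    then show ?thesis
      using L2_norm_nonneg[of ?u] \<open>M \<ge> 0\<close> \<open>0 < \<eta>\<close>
      by (cases "L2_norm ?u = 0") (auto simp: mult_le_cancel_right)
  qed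
  have "ennreal (L2_norm (Q_op N x q I f)) \<le> ennreal (sqrt (1 + \<eta>)) * unif_norm f"
  proof (cases f rule: unif_norm_cases)
    case infinite
    \<comment> \<open>In \<open>ennreal\<close>, 0 times \<open>top\<close> is 0, so positivity of
      the coefficient is what makes the right-hand side infinite.\<close>
    then show ?thesis using \<open>0 < \<eta>\<close> by (simp add: ennreal_mult_top)
  next
    case (finite M)
    then show ?thesis
      using stability[of f M] \<open>0 < \<eta>\<close> by (simp add: ennreal_mult[symmetric])
  qed
  moreover have "ennreal (L2_norm (Q_op N x q I f - f))
      \<le> ennreal (sqrt (1 + \<eta>) + 1) * unif_norm (f - p)
        + ennreal (L2_norm (Q_op N x q I p - p))"
    if "best_unif_approx (P_space q I) f p" for p
  proof (cases "f - p" rule: unif_norm_cases)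
    case infinite
    have "sqrt (1 + \<eta>) + 1 > 0" using \<open>0 < \<eta>\<close> by (simp add: add_pos_pos)
    then show ?thesis using infinite by (simp add: ennreal_mult_top)
  next
    case (finite M)
    have p: "p \<in> P_space q I"
      using that by (simp add: best_unif_approx_def)
    note L2 = P_L2[OF p] P_L2[OF Q_in_P] \<open>f \<in> L2_space\<close>
    \<comment> \<open>Linearity of \<open>Q_op\<close> in its argument makes the inserted terms in
      \<open>p\<close> cancel.\<close>
    have "L2_norm (Q_op N x q I f - f)
        = L2_norm ((Q_op N x q I (f - p) + (p - f)) + (Q_op N x q I p - p))"
      by (simp add: Q_op_diff)
    also have "\<dots> \<le> L2_norm (Q_op N x q I (f - p) + (p - f)) + L2_norm (Q_op N x q I p - p)"
      by (intro L2_norm_triangle L2_space_add L2_space_diff L2)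
    also have "\<dots> \<le> L2_norm (Q_op N x q I (f - p)) + L2_norm (p - f) + L2_norm (Q_op N x q I p - p)"
      by (intro add_right_mono L2_norm_triangle L2_space_diff L2)
    \<comment> \<open>The first summand is bounded by stability, the second by the unit-volume
      estimate for functions bounded by \<open>M\<close>.\<close>
    also have "\<dots> \<le> sqrt (1 + \<eta>) * M + M + L2_norm (Q_op N x q I p - p)"
      using stability[of "f - p" M] L2_norm_le_bound[of "f - p" M] finite L2
      by (simp add: L2_space_diff L2_norm_minus_commute[of p f])
    finally have "L2_norm (Q_op N x q I f - f)
        \<le> (sqrt (1 + \<eta>) + 1) * M + L2_norm (Q_op N x q I p - p)"
      by (simp add: algebra_simps)
    then have "ennreal (L2_norm (Q_op N x q I f - f))
        \<le> ennreal ((sqrt (1 + \<eta>) + 1) * M + L2_norm (Q_op N x q I p - p))"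
      by (rule ennreal_leI)
    also have "\<dots> = ennreal (sqrt (1 + \<eta>) + 1) * unif_norm (f - p)
        + ennreal (L2_norm (Q_op N x q I p - p))"
      using finite \<open>0 < \<eta>\<close> by (simp add: ennreal_mult ennreal_plus L2_norm_nonneg)
    finally show ?thesis .
  qed
  ultimately show ?thesis by blast
qed

end
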